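(* Let $F : \mathbb{R}^n \to \mathbb{R}^n$ be a payment-free Shapley operator. Then, for all $\varepsilon > 0$, there exists a payment-free Shapley operator $G : \mathbb{R}^n \to \mathbb{R}^n$ such that $$F_i(x) \leq G_i(x) \leq F_i(x) + \varepsilon \|x\|_\infty$$ for all $x \in \mathbb{R}^n$ and $1 \leq i \leq n$, and which can be represented in the form $$G_i(x) = \min_{a \in A_i} \; \max_{b \in B_{i,a}} \; \sum_{j=1}^n P_{ij}^{ab} x_j , \quad \forall x \in \mathbb{R}^n,\ \forall i \in \{1,\dots,n\},$$ where the sets $A_i$ and $B_{i,a}$ are finite, and every $P_i^{ab} = (P_{ij}^{ab})_{1 \leq j \leq n}$ is a stochastic vector with at most two positive coordinates.
   Context: $\mathbb{R}^n$ is equipped with the standard (coordinatewise) partial order, and $e$ denotes the vector with all entries equal to $1$; $\|x\|_\infty = \max_i |x_i|$. A payment-free Shapley operator is a map $F = (F_1,\dots,F_n): \mathbb{R}^n \to \mathbb{R}^n$ that is monotone ($x \leq y$ implies $F(x) \leq F(y)$), additively homogeneous ($F(\lambda e + x) = \lambda e + F(x)$ for all $\lambda \in \mathbb{R}$, $x \in \mathbb{R}^n$) and positively homogeneous ($F(\lambda x) = \lambda F(x)$ for all $\lambda \geq 0$, $x \in \mathbb{R}^n$). A stochastic vector is a vector with nonnegative coordinates summing to $1$. *)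

theory Defs
  imports "HOL-Analysis.Analysis"
begin

text \<open>
  The space of real vectors with \<open>n\<close> coordinates is \<open>real ^ 'n\<close>, with the coordinatewise order;
  \<open>vec 1\<close> is the vector \<open>e\<close> with all entries equal to 1, and \<open>infnorm\<close> is the sup-norm.
\<close>

definition payment_free_shapley :: "(real ^ 'n \<Rightarrow> real ^ 'n) \<Rightarrow> bool" where
  "payment_free_shapley F \<longleftrightarrow>
     mono F \<and>
     (\<forall>c x. F (c *\<^sub>R vec 1 + x) = c *\<^sub>R vec 1 + F x) \<and>
     (\<forall>c x. c \<ge> 0 \<longrightarrow> F (c *\<^sub>R x) = c *\<^sub>R F x)"

definition stochastic_vector :: "real ^ 'n \<Rightarrow> bool" where
  "stochastic_vector p \<longleftrightarrow> (\<forall>j. p $ j \<ge> 0) \<and> (\<Sum>j\<in>UNIV. p $ j) = 1"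

text \<open>
  The finite sets \<open>A\<^sub>i\<close> and \<open>B\<^sub>i\<^sub>,\<^sub>a\<close> carry no structure, so they are taken, without loss of
  generality, to consist of natural numbers. They must be nonempty for the minimum and the
  maxima to exist; \<open>Min\<close> and \<open>Max\<close> are unspecified on the empty set.
\<close>

definition finite_minimax_representation ::
  "(real ^ 'n \<Rightarrow> real ^ 'n) \<Rightarrow> ('n \<Rightarrow> nat set) \<Rightarrow> ('n \<Rightarrow> nat \<Rightarrow> nat set) \<Rightarrow>
   ('n \<Rightarrow> nat \<Rightarrow> nat \<Rightarrow> real ^ 'n) \<Rightarrow> bool" where
  "finite_minimax_representation G A B P \<longleftrightarrow>
     (\<forall>i. finite (A i) \<and> A i \<noteq> {}) \<and>
     (\<forall>i. \<forall>a\<in>A i. finite (B i a) \<and> B i a \<noteq> {}) \<and>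
     (\<forall>i. \<forall>a\<in>A i. \<forall>b\<in>B i a. stochastic_vector (P i a b)) \<and>
     (\<forall>x i. G x $ i =
        (MIN a\<in>A i. MAX b\<in>B i a. \<Sum>j\<in>UNIV. P i a b $ j * x $ j))"

end

theory Submission imports Defs begin

text \<open>
  Fix a coordinate \<open>i\<close> and put \<open>f x = F x $ i\<close>. Such an \<open>f\<close> obeys \<open>f (a y + b e) = a f y + b\<close> for
  \<open>a \<ge> 0\<close>, so by monotonicity \<open>x \<le> a y + b e\<close> implies \<open>f x \<le> a f y + b\<close>. The least upper bound on
  \<open>f x\<close> obtained in this way is a linear program, with dual: maximise \<open>p \<bullet> x\<close> over the stochastic
  vectors \<open>p\<close> with \<open>p \<bullet> y \<le> f y\<close>. The feasible set is a simplex cut by one half-space. Its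
  vertices are vertices of the simplex or points on edges of the simplex, so they have at most two
  positive coordinates, and there are finitely many of them. The maximum \<open>g\<^sub>y x\<close> of \<open>p \<bullet> x\<close> over
  these vertices therefore dominates \<open>f\<close> everywhere (lemma \<open>shapley_le_at_cut_vertex\<close>, from the
  explicit \<open>a\<close> and \<open>b\<close> of lemma \<open>cut_vertices_dual_solution\<close>), and \<open>g\<^sub>y y \<le> f y\<close> by construction.

  All these functions are nonexpansive in the sup-norm, so \<open>g\<^sub>y\<close> exceeds \<open>f\<close> by at most
  \<open>2 \<delta>\<close> at distance \<open>\<delta>\<close> from \<open>y\<close>. Let \<open>y\<close> range over a finite \<open>\<epsilon>/2\<close>-net of a ball that
  contains the sup-norm unit sphere. The minimum of the \<open>g\<^sub>y\<close> lies between \<open>f\<close> and \<open>f + \<epsilon>\<close> on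
  that sphere, and positive homogeneity carries the bound to every \<open>x\<close>.
\<close>

section \<open>Payment-free Shapley operators\<close>

lemma payment_free_shapleyD:
  assumes "payment_free_shapley F"
  shows "x \<le> y \<Longrightarrow> F x $ i \<le> F y $ i"
    and "F (c *\<^sub>R vec 1 + x) $ i = c + F x $ i"
    and "0 \<le> c \<Longrightarrow> F (c *\<^sub>R x) $ i = c * F x $ i"
  using assms by (auto simp: payment_free_shapley_def mono_def less_eq_vec_def)

lemma shapley_zero:
  assumes "payment_free_shapley F"
  shows "F 0 $ i = 0"
  using payment_free_shapleyD(3)[OF assms, of 0 0 i] by simp

lemma shapley_nonexpansive:
  assumes "payment_free_shapley F"
  shows "F x $ i \<le> F y $ i + infnorm (x - y)"
proof -
  have "x \<le> infnorm (x - y) *\<^sub>R vec 1 + y"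
    using component_le_infnorm_cart[of "x - y"] by (auto simp: less_eq_vec_def abs_le_iff algebra_simps)
  then show ?thesis
    using payment_free_shapleyD(1,2)[OF assms] by (metis add.commute)
qed

text \<open>This makes the half-space \<open>p \<bullet> y \<le> F y $ i\<close> contain a vertex of the standard simplex.\<close>

lemma shapley_ge_some_coordinate:
  assumes "payment_free_shapley F"
  shows "\<exists>j. y $ j \<le> F y $ i"
proof -
  define m where "m = Min (range (($) y))"
  have "m \<in> range (($) y)" unfolding m_def by (intro Min_in) auto
  then obtain j where j: "y $ j = m" by auto
  have "m *\<^sub>R vec 1 + 0 \<le> y" by (auto simp: less_eq_vec_def m_def)
  from payment_free_shapleyD(1)[OF assms this, of i] have "m \<le> F y $ i"
    unfolding payment_free_shapleyD(2)[OF assms] shapley_zero[OF assms] by simp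
  with j show ?thesis by blast
qed

section \<open>Minimax functions of finite families of stochastic vectors\<close>

lemma stochastic_inner_one: "stochastic_vector p \<Longrightarrow> p \<bullet> 1 = 1"
  by (simp add: stochastic_vector_def inner_vec_def)

lemma stochastic_inner_mono: "stochastic_vector p \<Longrightarrow> x \<le> y \<Longrightarrow> p \<bullet> x \<le> p \<bullet> y"
  by (auto simp: stochastic_vector_def inner_vec_def less_eq_vec_def intro!: sum_mono mult_left_mono)

lemma stochastic_inner_nonexpansive:
  assumes "stochastic_vector p"
  shows "p \<bullet> x \<le> p \<bullet> y + infnorm (x - y)"
proof -
  have "x \<le> infnorm (x - y) *\<^sub>R vec 1 + y"
    using component_le_infnorm_cart[of "x - y"] by (auto simp: less_eq_vec_def abs_le_iff algebra_simps)
  from stochastic_inner_mono[OF assms this] show ?thesis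
    by (simp add: inner_add_right stochastic_inner_one[OF assms])
qed

definition minimax :: "(real ^ 'n) set set \<Rightarrow> real ^ 'n \<Rightarrow> real" where
  "minimax V x = (MIN S\<in>V. MAX p\<in>S. p \<bullet> x)"

definition stochastic_families :: "(real ^ 'n) set set \<Rightarrow> bool" where
  "stochastic_families V \<longleftrightarrow> finite V \<and> V \<noteq> {} \<and>
     (\<forall>S\<in>V. finite S \<and> S \<noteq> {} \<and> (\<forall>p\<in>S. stochastic_vector p))"

lemma minimax_le_iff:
  assumes "stochastic_families V"
  shows "minimax V x \<le> c \<longleftrightarrow> (\<exists>S\<in>V. \<forall>p\<in>S. p \<bullet> x \<le> c)"
  using assms unfolding minimax_def stochastic_families_def
  by (subst Min_le_iff) (auto simp: Max_le_iff)

lemma minimax_eqI: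
  assumes "stochastic_families V" "\<And>c. (\<exists>S\<in>V. \<forall>p\<in>S. p \<bullet> x \<le> c) \<longleftrightarrow> z \<le> c"
  shows "minimax V x = z"
  using minimax_le_iff[OF assms(1)] assms(2) by (meson order_antisym order_refl)

lemma payment_free_shapley_minimax:
  fixes V :: "'n \<Rightarrow> (real ^ 'n) set set"
  assumes V: "\<And>i. stochastic_families (V i)"
  shows "payment_free_shapley (\<lambda>x. \<chi> i. minimax (V i) x)"
proof -
  have st: "stochastic_vector p" if "S \<in> V i" "p \<in> S" for i S p
    using V that unfolding stochastic_families_def by blast
  have "minimax (V i) x \<le> minimax (V i) y" if "x \<le> y" for i x y
    using minimax_le_iff[OF V, of i x] minimax_le_iff[OF V, of i y] stochastic_inner_mono[OF st that]
    by (meson order_refl order_trans)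
  moreover have "minimax (V i) (c *\<^sub>R vec 1 + x) = c + minimax (V i) x" for i c x
  proof (rule minimax_eqI[OF V])
    fix d
    have "(\<exists>S\<in>V i. \<forall>p\<in>S. p \<bullet> (c *\<^sub>R vec 1 + x) \<le> d) \<longleftrightarrow> (\<exists>S\<in>V i. \<forall>p\<in>S. p \<bullet> x \<le> d - c)"
      using st by (intro bex_cong ball_cong refl)
        (simp add: inner_add_right stochastic_inner_one le_diff_eq add.commute)
    also have "\<dots> \<longleftrightarrow> c + minimax (V i) x \<le> d"
      unfolding minimax_le_iff[OF V, symmetric] by auto
    finally show "(\<exists>S\<in>V i. \<forall>p\<in>S. p \<bullet> (c *\<^sub>R vec 1 + x) \<le> d) \<longleftrightarrow> c + minimax (V i) x \<le> d" .
  qed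
  moreover have "minimax (V i) (c *\<^sub>R x) = c * minimax (V i) x" if "0 \<le> c" for i c x
  proof (cases "c = 0")
    case True
    have "minimax (V i) 0 = (MIN S\<in>V i. 0)"
      unfolding minimax_def using V[of i]
      by (intro arg_cong[where f = Min] image_cong refl) (auto simp: stochastic_families_def image_constant_conv)
    also have "\<dots> = 0" using V[of i] by (auto simp: stochastic_families_def image_constant_conv)
    finally show ?thesis using True by simp
  next
    case False
    with that have "c > 0" by simp
    show ?thesis
    proof (rule minimax_eqI[OF V])
      fix d
      have "(\<exists>S\<in>V i. \<forall>p\<in>S. p \<bullet> (c *\<^sub>R x) \<le> d) \<longleftrightarrow> (\<exists>S\<in>V i. \<forall>p\<in>S. p \<bullet> x \<le> d / c)"
        using \<open>c > 0\<close> by (simp add: pos_le_divide_eq mult.commute)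
      also have "\<dots> \<longleftrightarrow> c * minimax (V i) x \<le> d"
        unfolding minimax_le_iff[OF V, symmetric]
        using \<open>c > 0\<close> by (simp add: pos_le_divide_eq mult.commute)
      finally show "(\<exists>S\<in>V i. \<forall>p\<in>S. p \<bullet> (c *\<^sub>R x) \<le> d) \<longleftrightarrow> c * minimax (V i) x \<le> d" .
    qed
  qed
  ultimately show ?thesis
    by (auto simp: payment_free_shapley_def mono_def less_eq_vec_def vec_eq_iff)
qed

text \<open>
  Numbering the members of the finite families by naturals gives the index sets of a finite minimax
  representation.
\<close>

lemma minimax_representation:
  fixes V :: "'n \<Rightarrow> (real ^ 'n) set set"
  assumes V: "\<And>i. stochastic_families (V i)"
  obtains A B P where "finite_minimax_representation (\<lambda>x. \<chi> i. minimax (V i) x) A B P"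
    and "\<And>i a b. a \<in> A i \<Longrightarrow> b \<in> B i a \<Longrightarrow> \<exists>S\<in>V i. P i a b \<in> S"
proof -
  define A where "A i = to_nat_on (V i) ` V i" for i
  define C where "C i a = from_nat_into (V i) a" for i and a :: nat
  define B where "B i a = to_nat_on (C i a) ` C i a" for i a
  define P where "P i a b = from_nat_into (C i a) b" for i a and b :: nat
  have C: "C i (to_nat_on (V i) S) = S" if "S \<in> V i" for i S
    using V[of i] that by (simp add: C_def stochastic_families_def countable_finite)
  have mem: "C i a \<in> V i" if "a \<in> A i" for i a
    using that C by (auto simp: A_def)
  have P: "P i a (to_nat_on (C i a) p) = p" if "a \<in> A i" "p \<in> C i a" for i a p
    using V[of i] mem[OF that(1)] that
    by (simp add: P_def stochastic_families_def countable_finite)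
  have in_C: "P i a b \<in> C i a" if "a \<in> A i" "b \<in> B i a" for i a b
    using that P by (auto simp: B_def)
  have max_eq: "(MAX b\<in>B i a. \<Sum>j\<in>UNIV. P i a b $ j * x $ j) = (MAX p\<in>C i a. p \<bullet> x)"
    if "a \<in> A i" for i a x
    unfolding B_def image_image inner_vec_def inner_real_def
    using P[OF that] by (intro arg_cong[where f = Max] image_cong refl) simp
  have min_eq: "(MIN a\<in>A i. MAX b\<in>B i a. \<Sum>j\<in>UNIV. P i a b $ j * x $ j) = minimax (V i) x" for i x
  proof -
    have "(MIN a\<in>A i. MAX b\<in>B i a. \<Sum>j\<in>UNIV. P i a b $ j * x $ j) = (MIN a\<in>A i. MAX p\<in>C i a. p \<bullet> x)"
      by (intro arg_cong[where f = Min] image_cong refl max_eq)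
    also have "\<dots> = minimax (V i) x"
      unfolding A_def image_image minimax_def
      by (intro arg_cong[where f = Min] image_cong refl) (simp add: C)
    finally show ?thesis .
  qed
  have "finite (A i) \<and> A i \<noteq> {}" for i
    using V[of i] by (auto simp: A_def stochastic_families_def)
  moreover have "finite (B i a) \<and> B i a \<noteq> {}" if "a \<in> A i" for i a
    using V[of i] mem[OF that] by (auto simp: B_def stochastic_families_def)
  moreover have "stochastic_vector (P i a b)" if "a \<in> A i" "b \<in> B i a" for i a b
    using V[of i] mem[OF that(1)] in_C[OF that] by (auto simp: stochastic_families_def)
  ultimately have "finite_minimax_representation (\<lambda>x. \<chi> i. minimax (V i) x) A B P"
    unfolding finite_minimax_representation_def by (simp add: min_eq)
  then show thesis using that in_C mem by blast
qed

section \<open>The vertices of a simplex cut by a half-space\<close>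

text \<open>
  The point on the edge between the vertices \<open>j\<close> and \<open>k\<close> of the standard simplex at which the
  linear form \<open>p \<mapsto> p \<bullet> y\<close> takes the value \<open>c\<close>, provided that \<open>y $ j < c < y $ k\<close>.
\<close>

definition edge_point :: "real ^ 'n \<Rightarrow> real \<Rightarrow> 'n \<Rightarrow> 'n \<Rightarrow> real ^ 'n" where
  "edge_point y c j k =
     ((y $ k - c) / (y $ k - y $ j)) *\<^sub>R axis j 1 + ((c - y $ j) / (y $ k - y $ j)) *\<^sub>R axis k 1"

text \<open>The vertices of the polytope of all stochastic vectors \<open>p\<close> with \<open>p \<bullet> y \<le> c\<close>.\<close>

definition cut_vertices :: "real ^ 'n \<Rightarrow> real \<Rightarrow> (real ^ 'n) set" where
  "cut_vertices y c = (\<lambda>j. axis j 1) ` {j. y $ j \<le> c} \<union>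
     (\<lambda>(j, k). edge_point y c j k) ` ({j. y $ j < c} \<times> {k. c < y $ k})"

lemma finite_cut_vertices: "finite (cut_vertices y c)"
  by (simp add: cut_vertices_def)

lemma inner_edge_point:
  "edge_point y c j k \<bullet> x = ((y $ k - c) * x $ j + (c - y $ j) * x $ k) / (y $ k - y $ j)"
  by (simp add: edge_point_def inner_add_left inner_axis' add_divide_distrib)

lemma stochastic_axis: "stochastic_vector (axis j 1)"
  by (simp add: stochastic_vector_def axis_def)

lemma stochastic_edge_point:
  assumes "y $ j < c" "c < y $ k"
  shows "stochastic_vector (edge_point y c j k)"
proof -
  have "(\<Sum>l\<in>UNIV. edge_point y c j k $ l) = edge_point y c j k \<bullet> vec 1"
    by (simp add: inner_vec_def)
  also have "\<dots> = 1" unfolding inner_edge_point using assms by simp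
  finally show ?thesis
    using assms by (simp add: stochastic_vector_def edge_point_def axis_def)
qed

lemma stochastic_cut_vertex: "p \<in> cut_vertices y c \<Longrightarrow> stochastic_vector p"
  by (auto simp: cut_vertices_def stochastic_axis stochastic_edge_point)

lemma card_support_cut_vertex:
  assumes "p \<in> cut_vertices y c"
  shows "card {l. p $ l > 0} \<le> 2"
proof -
  obtain j k where "{l. p $ l > 0} \<subseteq> {j, k}"
  proof -
    from assms consider j where "p = axis j 1" | j k where "p = edge_point y c j k"
      by (auto simp: cut_vertices_def)
    then show thesis
    proof cases
      case 1
      then show thesis by (intro that[of j j]) (auto simp: axis_def split: if_splits)
    next
      case 2
      then show thesis by (intro that[of j k]) (auto simp: edge_point_def axis_def split: if_splits)
    qed
  qed
  then have "card {l. p $ l > 0} \<le> card {j, k}" by (intro card_mono) auto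
  also have "\<dots> \<le> 2" by (simp add: card_insert_if)
  finally show ?thesis .
qed

lemma cut_vertex_inner_le:
  assumes "p \<in> cut_vertices y c"
  shows "p \<bullet> y \<le> c"
proof -
  have "edge_point y c j k \<bullet> y = c" if "y $ j < c" "c < y $ k" for j k
    unfolding inner_edge_point using that by (simp add: field_simps)
  then show ?thesis
    using assms by (auto simp: cut_vertices_def inner_axis')
qed

text \<open>
  The dual of maximising \<open>p \<bullet> x\<close> over the cut simplex asks for a bound \<open>x \<le> a y + b e\<close> with
  \<open>a \<ge> 0\<close> and \<open>a c + b\<close> minimal. Setting \<open>a c + b = M\<close> and eliminating \<open>b\<close>, the requirement on \<open>a\<close> is a lower bound
  for every coordinate with \<open>y $ k > c\<close> and an upper bound for every coordinate with \<open>y $ j < c\<close>. The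
  edge point of \<open>j\<close> and \<open>k\<close> says that the two bounds are compatible.
\<close>

lemma cut_vertices_dual_solution:
  assumes M: "\<And>p. p \<in> cut_vertices y c \<Longrightarrow> p \<bullet> x \<le> M"
  obtains a where "0 \<le> a" "x \<le> (M - a * c) *\<^sub>R vec 1 + a *\<^sub>R y"
proof -
  define R where "R = insert 0 ((\<lambda>k. (x $ k - M) / (y $ k - c)) ` {k. c < y $ k})"
  define a where "a = Max R"
  have fin: "finite R" by (simp add: R_def)
  have low: "x $ j \<le> M" if "y $ j \<le> c" for j
    using M[of "axis j 1"] that by (simp add: cut_vertices_def inner_axis')
  have "x $ l \<le> M + a * (y $ l - c)" for l
  proof -
    consider "y $ l = c" | "c < y $ l" | "y $ l < c" by linarith
    then show ?thesis
    proof cases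
      case 1
      then show ?thesis using low[of l] by simp
    next
      case 2
      then have "(x $ l - M) / (y $ l - c) \<le> a"
        unfolding a_def by (intro Max_ge[OF fin]) (auto simp: R_def)
      then show ?thesis using 2 by (simp add: pos_divide_le_eq)
    next
      case 3
      have "a \<le> (M - x $ l) / (c - y $ l)"
        unfolding a_def
      proof (rule Max.boundedI[OF fin])
        show "R \<noteq> {}" by (simp add: R_def)
        fix r assume "r \<in> R"
        then consider "r = 0" | k where "c < y $ k" "r = (x $ k - M) / (y $ k - c)"
          by (auto simp: R_def)
        then show "r \<le> (M - x $ l) / (c - y $ l)"
        proof cases
          case 1
          then show ?thesis using 3 low[of l] by simp
        next
          case (2 k)
          have "edge_point y c l k \<in> cut_vertices y c"
            unfolding cut_vertices_def using 2 3 by force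
          from M[OF this]
          have "(y $ k - c) * x $ l + (c - y $ l) * x $ k \<le> M * (y $ k - y $ l)"
            unfolding inner_edge_point using 2 3 by (simp add: pos_divide_le_eq)
          then have "(x $ k - M) * (c - y $ l) \<le> (M - x $ l) * (y $ k - c)"
            by (simp add: algebra_simps)
          then show ?thesis using 2 3 by (simp add: divide_le_eq pos_le_divide_eq)
        qed
      qed
      then show ?thesis using 3 by (simp add: pos_le_divide_eq algebra_simps)
    qed
  qed
  then have "x \<le> (M - a * c) *\<^sub>R vec 1 + a *\<^sub>R y"
    by (simp add: less_eq_vec_def algebra_simps)
  moreover have "0 \<le> a" unfolding a_def by (rule Max_ge[OF fin]) (simp add: R_def)
  ultimately show thesis using that by blast
qed

lemma shapley_le_at_cut_vertex:
  assumes "payment_free_shapley F"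
    and "\<And>p. p \<in> cut_vertices y (F y $ i) \<Longrightarrow> p \<bullet> x \<le> M"
  shows "F x $ i \<le> M"
proof -
  obtain a where a: "0 \<le> a" "x \<le> (M - a * F y $ i) *\<^sub>R vec 1 + a *\<^sub>R y"
    using cut_vertices_dual_solution[OF assms(2)] by blast
  show ?thesis
    using payment_free_shapleyD(1)[OF assms(1) a(2), of i]
    unfolding payment_free_shapleyD(2)[OF assms(1)] payment_free_shapleyD(3)[OF assms(1) a(1)]
    by simp
qed

section \<open>Approximation from above\<close>

theorem corollary4p5:
  fixes F :: "real ^ 'n \<Rightarrow> real ^ 'n"
  assumes "payment_free_shapley F"
  shows "\<forall>\<epsilon>>0. \<exists>G :: real ^ 'n \<Rightarrow> real ^ 'n.
           payment_free_shapley G \<and>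
           (\<forall>x i. F x $ i \<le> G x $ i \<and> G x $ i \<le> F x $ i + \<epsilon> * infnorm x) \<and>
           (\<exists>A B P. finite_minimax_representation G A B P \<and>
              (\<forall>i. \<forall>a\<in>A i. \<forall>b\<in>B i a. card {j. P i a b $ j > 0} \<le> 2))"
proof (intro allI impI)
  fix \<epsilon> :: real assume "\<epsilon> > 0"
  \<comment> \<open>A Euclidean ball of this radius contains the sup-norm unit sphere.\<close>
  define K where "K = cball (0 :: real ^ 'n) (sqrt DIM(real ^ 'n))"
  have "compact K" by (simp add: K_def)
  then obtain N where N: "finite N" "K \<subseteq> (\<Union>y\<in>N. ball y (\<epsilon> / 2))"
    unfolding compact_eq_totally_bounded using \<open>\<epsilon> > 0\<close> by (meson half_gt_zero)
  have "N \<noteq> {}" using N(2) by (auto simp: K_def)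
  define V where "V i = (\<lambda>y. cut_vertices y (F y $ i)) ` N" for i
  have V: "stochastic_families (V i)" for i
  proof -
    have "cut_vertices y (F y $ i) \<noteq> {}" for y
      using shapley_ge_some_coordinate[OF assms, of y i] by (auto simp: cut_vertices_def)
    then show ?thesis
      using N(1) \<open>N \<noteq> {}\<close>
      by (auto simp: stochastic_families_def V_def finite_cut_vertices stochastic_cut_vertex)
  qed
  define G where "G x = (\<chi> i. minimax (V i) x)" for x
  have G: "payment_free_shapley G"
    unfolding G_def by (rule payment_free_shapley_minimax[OF V])
  have lower: "F x $ i \<le> G x $ i" for x i
  proof -
    obtain y where "\<forall>p\<in>cut_vertices y (F y $ i). p \<bullet> x \<le> G x $ i"
      using minimax_le_iff[OF V, of i x "G x $ i"] by (auto simp: G_def V_def)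
    then show ?thesis using shapley_le_at_cut_vertex[OF assms] by blast
  qed
  have on_ball: "G x $ i \<le> F x $ i + \<epsilon>" if x: "x \<in> K" for x i
  proof -
    obtain y where y: "y \<in> N" "dist y x < \<epsilon> / 2" using N(2) x by auto
    have near: "infnorm (x - y) < \<epsilon> / 2" "infnorm (y - x) < \<epsilon> / 2"
      using y(2) infnorm_le_norm[of "y - x"] infnorm_sub[of x y] by (auto simp: dist_norm)
    have "p \<bullet> x \<le> F x $ i + \<epsilon>" if "p \<in> cut_vertices y (F y $ i)" for p
      using cut_vertex_inner_le[OF that] near shapley_nonexpansive[OF assms, of y i x]
        stochastic_inner_nonexpansive[OF stochastic_cut_vertex[OF that], of x y] by linarith
    then have "minimax (V i) x \<le> F x $ i + \<epsilon>"
      unfolding minimax_le_iff[OF V] using y(1) by (auto simp: V_def)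
    then show ?thesis by (simp add: G_def)
  qed
  have upper: "G x $ i \<le> F x $ i + \<epsilon> * infnorm x" for x i
  proof (cases "x = 0")
    case True
    then show ?thesis using shapley_zero[OF assms] shapley_zero[OF G] by (simp add: infnorm_0)
  next
    case False
    define t where "t = infnorm x"
    have "t > 0" using False by (simp add: t_def infnorm_pos_lt)
    define u where "u = (1 / t) *\<^sub>R x"
    have "norm u \<le> sqrt DIM(real ^ 'n)"
      using norm_le_infnorm[of x] \<open>t > 0\<close> unfolding u_def
      by (simp add: t_def[symmetric] pos_divide_le_eq)
    then have "G u $ i \<le> F u $ i + \<epsilon>" by (intro on_ball) (simp add: K_def)
    then have "t * G u $ i \<le> t * (F u $ i + \<epsilon>)" using \<open>t > 0\<close> by simp
    moreover have "t *\<^sub>R u = x" using \<open>t > 0\<close> by (simp add: u_def)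
    then have "F x $ i = t * F u $ i" "G x $ i = t * G u $ i"
      using payment_free_shapleyD(3)[OF assms, of t u i] payment_free_shapleyD(3)[OF G, of t u i]
        \<open>t > 0\<close> by auto
    ultimately show ?thesis by (simp add: t_def algebra_simps)
  qed
  obtain A B P where rep: "finite_minimax_representation G A B P"
    and mem: "\<And>i a b. a \<in> A i \<Longrightarrow> b \<in> B i a \<Longrightarrow> \<exists>S\<in>V i. P i a b \<in> S"
    using minimax_representation[of V, OF V] unfolding G_def[abs_def] by metis
  have "card {j. P i a b $ j > 0} \<le> 2" if "a \<in> A i" "b \<in> B i a" for i a b
    using mem[OF that] by (auto simp: V_def card_support_cut_vertex)
  with G lower upper rep
  show "\<exists>G :: real ^ 'n \<Rightarrow> real ^ 'n.
           payment_free_shapley G \<and>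
           (\<forall>x i. F x $ i \<le> G x $ i \<and> G x $ i \<le> F x $ i + \<epsilon> * infnorm x) \<and>
           (\<exists>A B P. finite_minimax_representation G A B P \<and>
              (\<forall>i. \<forall>a\<in>A i. \<forall>b\<in>B i a. card {j. P i a b $ j > 0} \<le> 2))"
    by blast
qed

end
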